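(* Let $1\le p<\infty$ and let $(X_n)_{n\in\mathbb N}$ be a sequence of Banach spaces. Then $X_n$ has the $p$-$(DPrcP)$ for all $n\in\mathbb N$ if and only if $\left(\sum_{n=1}^\infty\oplus X_n\right)_{\ell_1}$ has the $p$-$(DPrcP)$.
   Context: A sequence $(x_n)_n$ in a Banach space $X$ is weakly $p$-summable if $(x^*(x_n))_n\in\ell_p$ for every $x^*\in X^*$. A bounded set $K\subseteq X$ is a Dunford-Pettis set if every weakly null sequence $(x_n^* )_n$ in $X^*$ converges to $0$ uniformly on $K$. A Banach space $X$ has the $p$-Dunford-Pettis relatively compact property ($p$-$(DPrcP)$) if every weakly $p$-summable sequence in $X$ whose set of terms is a Dunford-Pettis set is norm null. $\left(\sum_{n=1}^\infty\oplus X_n\right)_{\ell_1}$ is the space of all sequences $x=(x_n)_n$ with $x_n\in X_n$ and $\|x\|=\sum_{n}\|x_n\|<\infty$. *)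

theory Defs
  imports "HOL-Analysis.Analysis" "HOL-Algebra.Module"
begin

text \<open>The scalar field is the real or the complex field: up to an isometric isomorphism,
  these are the only members of the following class.\<close>

class real_or_complex = real_normed_field +
  assumes real_or_complex:
    "\<exists>\<phi> :: 'a \<Rightarrow> complex.
       (\<forall>a b. \<phi> (a + b) = \<phi> a + \<phi> b) \<and> (\<forall>a b. \<phi> (a * b) = \<phi> a * \<phi> b) \<and>
       (\<forall>r. \<phi> (r *\<^sub>R 1) = complex_of_real r) \<and> (\<forall>a. norm (\<phi> a) = norm a) \<and>
       (range \<phi> = \<real> \<or> range \<phi> = UNIV)"

instance real :: real_or_complex
proof
  show "\<exists>\<phi> :: real \<Rightarrow> complex.
       (\<forall>a b. \<phi> (a + b) = \<phi> a + \<phi> b) \<and> (\<forall>a b. \<phi> (a * b) = \<phi> a * \<phi> b) \<and>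
       (\<forall>r. \<phi> (r *\<^sub>R 1) = complex_of_real r) \<and> (\<forall>a. norm (\<phi> a) = norm a) \<and>
       (range \<phi> = \<real> \<or> range \<phi> = UNIV)"
    by (rule exI[of _ complex_of_real]) (simp add: Reals_def)
qed

instance complex :: real_or_complex
proof
  show "\<exists>\<phi> :: complex \<Rightarrow> complex.
       (\<forall>a b. \<phi> (a + b) = \<phi> a + \<phi> b) \<and> (\<forall>a b. \<phi> (a * b) = \<phi> a * \<phi> b) \<and>
       (\<forall>r. \<phi> (r *\<^sub>R 1) = complex_of_real r) \<and> (\<forall>a. norm (\<phi> a) = norm a) \<and>
       (range \<phi> = \<real> \<or> range \<phi> = UNIV)"
    by (rule exI[of _ "\<lambda>z. z"]) (simp add: scaleR_conv_of_real)
qed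

definition scalars :: "'k::real_or_complex ring" where
  "scalars = \<lparr>carrier = UNIV, mult = (*), one = 1, zero = 0, add = (+)\<rparr>"

text \<open>Normed spaces have explicit carriers, so that a sequence of unrelated spaces is a function
  on \<^typ>\<open>nat\<close>. The fields \<^const>\<open>mult\<close> and \<^const>\<open>one\<close> inherited from
  rings play no role.\<close>

record ('k, 'a) normed_module = "('k, 'a) module" +
  vnorm :: "'a \<Rightarrow> real"

locale normed_space = module scalars X
  for X :: "('k::real_or_complex, 'a) normed_module" (structure) +
  assumes vnorm_eq_0_iff: "x \<in> carrier X \<Longrightarrow> vnorm X x = 0 \<longleftrightarrow> x = \<zero>"
    and vnorm_triangle:
      "\<lbrakk>x \<in> carrier X; y \<in> carrier X\<rbrakk> \<Longrightarrow> vnorm X (x \<oplus> y) \<le> vnorm X x + vnorm X y"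
    and vnorm_smult: "x \<in> carrier X \<Longrightarrow> vnorm X (c \<odot>\<^bsub>X\<^esub> x) = norm c * vnorm X x"

locale banach_space = normed_space +
  assumes complete:
    "\<lbrakk>\<And>n. s n \<in> carrier X;
      \<And>e. e > 0 \<Longrightarrow> \<exists>N. \<forall>m\<ge>N. \<forall>n\<ge>N. vnorm X (s m \<ominus> s n) < e\<rbrakk> \<Longrightarrow>
     \<exists>l\<in>carrier X. (\<lambda>n::nat. vnorm X (s n \<ominus> l)) \<longlonglongrightarrow> 0"

text \<open>The dual space with the operator norm. Functionals are made extensional (equal to
  \<^const>\<open>undefined\<close> outside the carrier) so that equality of functionals is equality
  on the carrier.\<close>

definition dual_space ::
    "('k::real_or_complex, 'a) normed_module \<Rightarrow> ('k, 'a \<Rightarrow> 'k) normed_module" where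
  "dual_space X = \<lparr>
     carrier = {f \<in> extensional (carrier X).
       (\<forall>x\<in>carrier X. \<forall>y\<in>carrier X. f (x \<oplus>\<^bsub>X\<^esub> y) = f x + f y) \<and>
       (\<forall>c. \<forall>x\<in>carrier X. f (c \<odot>\<^bsub>X\<^esub> x) = c * f x) \<and>
       (\<exists>C. \<forall>x\<in>carrier X. norm (f x) \<le> C * vnorm X x)},
     mult = undefined, one = undefined,
     zero = (\<lambda>x\<in>carrier X. 0),
     add = (\<lambda>f g. \<lambda>x\<in>carrier X. f x + g x),
     smult = (\<lambda>c f. \<lambda>x\<in>carrier X. c * f x),
     vnorm = (\<lambda>f. SUP x\<in>{x \<in> carrier X. vnorm X x \<le> 1}. norm (f x))\<rparr>"

definition weakly_null ::
    "('k::real_or_complex, 'a) normed_module \<Rightarrow> (nat \<Rightarrow> 'a) \<Rightarrow> bool" where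
  "weakly_null X x \<longleftrightarrow> (\<forall>n. x n \<in> carrier X) \<and>
     (\<forall>f\<in>carrier (dual_space X). (\<lambda>n. f (x n)) \<longlonglongrightarrow> 0)"

definition weakly_p_summable ::
    "real \<Rightarrow> ('k::real_or_complex, 'a) normed_module \<Rightarrow> (nat \<Rightarrow> 'a) \<Rightarrow> bool" where
  "weakly_p_summable p X x \<longleftrightarrow> (\<forall>n. x n \<in> carrier X) \<and>
     (\<forall>f\<in>carrier (dual_space X). summable (\<lambda>n. norm (f (x n)) powr p))"

definition dunford_pettis_set ::
    "('k::real_or_complex, 'a) normed_module \<Rightarrow> 'a set \<Rightarrow> bool" where
  "dunford_pettis_set X K \<longleftrightarrow> K \<subseteq> carrier X \<and> (\<exists>B. \<forall>x\<in>K. vnorm X x \<le> B) \<and>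
     (\<forall>f. weakly_null (dual_space X) f \<longrightarrow> uniform_limit K f (\<lambda>_. 0) sequentially)"

definition p_DPrcP :: "real \<Rightarrow> ('k::real_or_complex, 'a) normed_module \<Rightarrow> bool" where
  "p_DPrcP p X \<longleftrightarrow>
     (\<forall>x. weakly_p_summable p X x \<longrightarrow> dunford_pettis_set X (range x) \<longrightarrow>
       (\<lambda>n. vnorm X (x n)) \<longlonglongrightarrow> 0)"

definition l1_sum ::
    "(nat \<Rightarrow> ('k::real_or_complex, 'a) normed_module) \<Rightarrow> ('k, nat \<Rightarrow> 'a) normed_module" where
  "l1_sum X = \<lparr>
     carrier = {x. (\<forall>n. x n \<in> carrier (X n)) \<and> summable (\<lambda>n. vnorm (X n) (x n))},
     mult = undefined, one = undefined,
     zero = (\<lambda>n. \<zero>\<^bsub>X n\<^esub>),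
     add = (\<lambda>x y n. x n \<oplus>\<^bsub>X n\<^esub> y n),
     smult = (\<lambda>c x n. c \<odot>\<^bsub>X n\<^esub> x n),
     vnorm = (\<lambda>x. \<Sum>n. vnorm (X n) (x n))\<rparr>"

end

theory Submission imports Defs begin

text \<open>
  Bounded operators preserve weakly \<open>p\<close>-summable sequences and Dunford-Pettis sets, because their
  adjoints are bounded operators between the dual spaces and therefore preserve weakly null
  sequences of functionals. Applied to the isometric inclusion of a summand, this carries the
  \<open>p\<close>-(DPrcP) from the \<open>\<ell>\<^sub>1\<close>-sum down to every summand. Applied to the coordinate projections, it
  shows that a weakly \<open>p\<close>-summable sequence in the \<open>\<ell>\<^sub>1\<close>-sum whose range is a Dunford-Pettis set
  tends to zero in every coordinate, as soon as all summands have the \<open>p\<close>-(DPrcP).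

  Coordinatewise convergence becomes convergence in norm because a Dunford-Pettis set \<open>K\<close> in an
  \<open>\<ell>\<^sub>1\<close>-sum has uniformly small tails (\<open>dunford_pettis_set_l1_sum_tails\<close>). This is a gliding hump
  argument. If the tails are not uniformly small, there are \<open>e > 0\<close>, consecutive disjoint blocks
  of coordinates, and elements \<open>y\<^sub>j\<close> of \<open>K\<close> whose part on the \<open>j\<close>-th block has norm greater than \<open>e\<close>.
  Let \<open>g\<^sub>j\<close> be the functional that applies, on each coordinate of the \<open>j\<close>-th block, a functional of
  norm at most one attaining the norm of that coordinate of \<open>y\<^sub>j\<close>. Since the blocks are disjoint,
  \<open>\<Sum>\<^sub>j |g\<^sub>j(x)| \<le> \<parallel>x\<parallel>\<close> for all \<open>x\<close>; hence all sums \<open>\<Sum>\<^sub>j c\<^sub>j g\<^sub>j\<close> with \<open>|c\<^sub>j| \<le> 1\<close> have norm at most one, so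
  \<open>\<Sum>\<^sub>j |\<phi>(g\<^sub>j)| < \<infinity>\<close> for every \<open>\<phi>\<close> in the bidual, and the \<open>g\<^sub>j\<close> are weakly null
  (\<open>weakly_null_dual_spaceI\<close>). But \<open>|g\<^sub>j(y\<^sub>j)| > e\<close> for all \<open>j\<close>, which contradicts the uniform
  convergence of \<open>g\<^sub>j\<close> to zero on \<open>K\<close>.

  The norm-attaining functionals come from the Hahn-Banach theorem
  (\<open>hahn_banach_norming\<close>), obtained here from minimal sublinear functionals.
\<close>

section \<open>Normed spaces with explicit carriers\<close>

lemma scalars_simps [simp]:
  "carrier scalars = UNIV" "a \<oplus>\<^bsub>scalars\<^esub> b = a + b" "a \<otimes>\<^bsub>scalars\<^esub> b = a * b"
  "\<zero>\<^bsub>scalars\<^esub> = 0" "\<one>\<^bsub>scalars\<^esub> = 1"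
  by (simp_all add: scalars_def)

context normed_space
begin

lemma scale_closed [simp, intro]: "x \<in> carrier X \<Longrightarrow> c \<odot> x \<in> carrier X"
  using smult_closed by simp

lemma scale_left_distrib: "x \<in> carrier X \<Longrightarrow> (a + b) \<odot> x = a \<odot> x \<oplus> b \<odot> x"
  using smult_l_distr[of a b x] by simp

lemma scale_right_distrib:
  "\<lbrakk>x \<in> carrier X; y \<in> carrier X\<rbrakk> \<Longrightarrow> a \<odot> (x \<oplus> y) = a \<odot> x \<oplus> a \<odot> y"
  using smult_r_distr[of a x y] by simp

lemma scale_scale: "x \<in> carrier X \<Longrightarrow> a \<odot> (b \<odot> x) = (a * b) \<odot> x"
  using smult_assoc1[of a b x] by simp

lemma scale_one [simp]: "x \<in> carrier X \<Longrightarrow> 1 \<odot> x = x"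
  using smult_one[of x] by simp

lemma scale_zero_left [simp]: "x \<in> carrier X \<Longrightarrow> 0 \<odot> x = \<zero>"
  using smult_l_null[of x] by simp

lemma scale_zero_right [simp]: "c \<odot> \<zero> = \<zero>"
  using smult_r_null[of c] by simp

lemma scale_minus_one: "x \<in> carrier X \<Longrightarrow> (- 1) \<odot> x = \<ominus> x"
  by (rule minus_equality[symmetric])
     (use scale_left_distrib[of x "- 1" 1] in \<open>simp_all\<close>)

lemma vnorm_zero [simp]: "vnorm X \<zero> = 0"
  by (simp add: vnorm_eq_0_iff)

lemma vnorm_minus [simp]: "x \<in> carrier X \<Longrightarrow> vnorm X (\<ominus> x) = vnorm X x"
  by (simp flip: scale_minus_one add: vnorm_smult)

lemma vnorm_nonneg [simp]: "x \<in> carrier X \<Longrightarrow> 0 \<le> vnorm X x"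
  using vnorm_triangle[of x "\<ominus> x"] by (simp add: r_neg)

end

section \<open>The Hahn-Banach theorem for real scalars\<close>

text \<open>
  Homogeneity is required only as an inequality, since the inequality for the inverse scalar
  gives the reverse one; this form passes directly to infima. Functionals are extensional, so
  that the pointwise order on the carrier is antisymmetric.
\<close>

definition sublinear_functionals ::
    "('k::real_or_complex, 'a) normed_module \<Rightarrow> ('a \<Rightarrow> real) set" where
  "sublinear_functionals X = {q \<in> extensional (carrier X).
     (\<forall>x\<in>carrier X. \<forall>y\<in>carrier X. q (x \<oplus>\<^bsub>X\<^esub> y) \<le> q x + q y) \<and>
     (\<forall>c>0. \<forall>x\<in>carrier X. q (of_real c \<odot>\<^bsub>X\<^esub> x) \<le> c * q x)}"

context normed_space
begin

lemma sublinear_functionals_add: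
  "\<lbrakk>q \<in> sublinear_functionals X; x \<in> carrier X; y \<in> carrier X\<rbrakk> \<Longrightarrow> q (x \<oplus> y) \<le> q x + q y"
  by (simp add: sublinear_functionals_def)

lemma sublinear_functionals_scale:
  assumes "q \<in> sublinear_functionals X" "x \<in> carrier X" "0 < c"
  shows "q (of_real c \<odot> x) = c * q x"
proof (rule antisym)
  show "q (of_real c \<odot> x) \<le> c * q x"
    using assms by (simp add: sublinear_functionals_def)
  have "q (of_real (inverse c) \<odot> (of_real c \<odot> x)) \<le> inverse c * q (of_real c \<odot> x)"
    using assms by (simp add: sublinear_functionals_def del: of_real_inverse)
  also have "of_real (inverse c) \<odot> (of_real c \<odot> x) = x"
    using assms by (simp add: scale_scale flip: of_real_mult del: of_real_inverse)
  finally show "c * q x \<le> q (of_real c \<odot> x)"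
    using \<open>0 < c\<close> by (simp add: field_simps)
qed

lemma sublinear_functionals_zero:
  assumes "q \<in> sublinear_functionals X"
  shows "q \<zero> = 0"
  using sublinear_functionals_scale[OF assms zero_closed, of 2] by simp

lemma sublinear_functionals_minus:
  assumes "q \<in> sublinear_functionals X" "x \<in> carrier X"
  shows "- q (\<ominus> x) \<le> q x"
  using sublinear_functionals_add[OF assms(1), of x "\<ominus> x"] sublinear_functionals_zero[OF assms(1)]
    assms(2) by (simp add: r_neg)

text \<open>
  Zorn's lemma for the reversed pointwise order: a chain has its pointwise infimum as a lower
  bound. The infimum is finite because each member satisfies \<open>q x \<ge> - q (- x) \<ge> - p (- x)\<close>. It is
  subadditive because two members \<open>q\<close> and \<open>r\<close> of a chain are comparable: the smaller of them is
  subadditive and bounds the infimum at \<open>x + y\<close> by \<open>q x + r y\<close>.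
\<close>

lemma exists_minimal_sublinear_functional:
  assumes p: "p \<in> sublinear_functionals X"
  shows "\<exists>q\<in>sublinear_functionals X. (\<forall>x\<in>carrier X. q x \<le> p x) \<and>
    (\<forall>r\<in>sublinear_functionals X. (\<forall>x\<in>carrier X. r x \<le> q x) \<longrightarrow> r = q)"
proof -
  define A where "A = {q \<in> sublinear_functionals X. \<forall>x\<in>carrier X. q x \<le> p x}"
  define P :: "('a \<Rightarrow> real) \<Rightarrow> ('a \<Rightarrow> real) \<Rightarrow> bool"
    where "P = (\<lambda>q r. \<forall>x\<in>carrier X. r x \<le> q x)"
  have ext: "q = r" if "q \<in> A" "r \<in> A" "P q r" "P r q" for q r
    using that by (intro extensionalityI[of q "carrier X" r])
      (auto simp: A_def P_def sublinear_functionals_def intro: antisym)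
  have "\<exists>m\<in>A. \<forall>a\<in>A. P m a \<longrightarrow> a = m"
  proof (rule predicate_Zorn)
    show "partial_order_on A (relation_of P A)"
      by (rule partial_order_on_relation_ofI) (use ext in \<open>auto simp: P_def intro: order_trans\<close>)
  next
    fix C assume C: "C \<in> Chains (relation_of P A)"
    then have CA: "C \<subseteq> A" by (rule Chains_relation_of)
    show "\<exists>u\<in>A. \<forall>a\<in>C. P a u"
    proof (cases "C = {}")
      case True
      then show ?thesis using p by (auto simp: A_def)
    next
      case False
      define u where "u = (\<lambda>x\<in>carrier X. INF q\<in>C. q x)"
      have bdd: "bdd_below ((\<lambda>q. q x) ` C)" if x: "x \<in> carrier X" for x
      proof (rule bdd_belowI2)
        fix q assume "q \<in> C"
        with CA have "q \<in> sublinear_functionals X" "q (\<ominus> x) \<le> p (\<ominus> x)"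
          using x by (auto simp: A_def)
        then show "- p (\<ominus> x) \<le> q x"
          using sublinear_functionals_minus[of q x] x by simp
      qed
      have le: "u x \<le> q x" if "q \<in> C" "x \<in> carrier X" for q x
        using that bdd by (auto simp: u_def intro: cINF_lower)
      have ge: "t \<le> u x" if "x \<in> carrier X" "\<And>q. q \<in> C \<Longrightarrow> t \<le> q x" for x t
        using that False by (auto simp: u_def intro: cINF_greatest)
      have "u \<in> sublinear_functionals X"
        unfolding sublinear_functionals_def
      proof (safe)
        show "u \<in> extensional (carrier X)" by (simp add: u_def)
      next
        fix x y assume xy: "x \<in> carrier X" "y \<in> carrier X"
        have "u (x \<oplus> y) \<le> q x + r y" if q: "q \<in> C" and r: "r \<in> C" for q r
        proof -
          have S: "q \<in> sublinear_functionals X" "r \<in> sublinear_functionals X"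
            using q r CA by (auto simp: A_def)
          have "P q r \<or> P r q"
            using C q r by (auto simp: Chains_def relation_of_def)
          then show ?thesis
          proof
            assume "P q r"
            then have "r x \<le> q x" using xy by (simp add: P_def)
            then show ?thesis
              using le[OF r, of "x \<oplus> y"] sublinear_functionals_add[OF S(2) xy] xy by simp
          next
            assume "P r q"
            then have "q y \<le> r y" using xy by (simp add: P_def)
            then show ?thesis
              using le[OF q, of "x \<oplus> y"] sublinear_functionals_add[OF S(1) xy] xy by simp
          qed
        qed
        then have "u (x \<oplus> y) - r y \<le> u x" if "r \<in> C" for r
          using that by (intro ge[OF xy(1)]) (simp add: algebra_simps)
        then have "u (x \<oplus> y) - u x \<le> u y"
          by (intro ge[OF xy(2)]) (simp add: algebra_simps)
        then show "u (x \<oplus> y) \<le> u x + u y" by simp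
      next
        fix c :: real and x assume c: "0 < c" and x: "x \<in> carrier X"
        have "u (of_real c \<odot> x) / c \<le> u x"
        proof (rule ge[OF x])
          fix q assume q: "q \<in> C"
          then have "q (of_real c \<odot> x) = c * q x"
            using CA x c by (intro sublinear_functionals_scale) (auto simp: A_def)
          then show "u (of_real c \<odot> x) / c \<le> q x"
            using le[OF q, of "of_real c \<odot> x"] x c by (simp add: field_simps)
        qed
        then show "u (of_real c \<odot> x) \<le> c * u x"
          using c by (simp add: field_simps)
      qed
      moreover have "u x \<le> p x" if "x \<in> carrier X" for x
      proof -
        obtain q where "q \<in> C" using False by blast
        then show ?thesis using le[of q x] CA that by (force simp: A_def)
      qed
      ultimately show ?thesis
        using le by (auto simp: A_def P_def)
    qed
  qed
  then obtain m where m: "m \<in> A" and min: "\<And>a. a \<in> A \<Longrightarrow> P m a \<Longrightarrow> a = m" by blast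
  show ?thesis
  proof (intro bexI[of _ m] conjI ballI impI)
    fix r assume "r \<in> sublinear_functionals X" "\<forall>x\<in>carrier X. r x \<le> m x"
    then show "r = m"
      using m by (intro min) (auto simp: A_def P_def intro: order_trans)
  qed (use m in \<open>auto simp: A_def\<close>)
qed

text \<open>
  The witness is \<open>r x = inf\<^bsub>t \<ge> 0\<^esub> (q (x + t y) - t q y)\<close>: the choice \<open>t = 0\<close>
  gives \<open>r \<le> q\<close>, and \<open>t = 1\<close> gives \<open>r (- y) \<le> - q y\<close>. A minimal \<open>q\<close> must coincide with
  this \<open>r\<close> for every \<open>y\<close> and is therefore odd.
\<close>

lemma exists_sublinear_functional_decreasing_at:
  assumes q: "q \<in> sublinear_functionals X" and y: "y \<in> carrier X"
  shows "\<exists>r\<in>sublinear_functionals X. (\<forall>x\<in>carrier X. r x \<le> q x) \<and> r (\<ominus> y) \<le> - q y"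
proof -
  define v where "v t x = q (x \<oplus> of_real t \<odot> y) - t * q y" for t x
  define r where "r = (\<lambda>x\<in>carrier X. INF t\<in>{0..}. v t x)"
  have qt: "q (of_real t \<odot> y) = t * q y" if "0 \<le> t" for t
    using sublinear_functionals_scale[OF q y, of t] sublinear_functionals_zero[OF q] y that
    by (cases "t = 0") auto
  have bdd: "bdd_below ((\<lambda>t. v t x) ` {0..})" if x: "x \<in> carrier X" for x
  proof (rule bdd_belowI2)
    fix t :: real assume "t \<in> {0..}"
    then have t: "0 \<le> t" by simp
    have "t * q y = q (\<ominus> x \<oplus> (x \<oplus> of_real t \<odot> y))"
      using x y by (simp add: qt[OF t] r_neg1)
    also have "\<dots> \<le> q (\<ominus> x) + q (x \<oplus> of_real t \<odot> y)"
      using x y by (intro sublinear_functionals_add[OF q]) auto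
    finally show "- q (\<ominus> x) \<le> v t x" by (simp add: v_def)
  qed
  have le: "r x \<le> v t x" if "0 \<le> t" "x \<in> carrier X" for t x
    using that bdd by (auto simp: r_def intro: cINF_lower)
  have ge: "s \<le> r x" if "x \<in> carrier X" "\<And>t. 0 \<le> t \<Longrightarrow> s \<le> v t x" for x s
    using that by (auto simp: r_def intro: cINF_greatest)
  have "r \<in> sublinear_functionals X"
    unfolding sublinear_functionals_def
  proof safe
    show "r \<in> extensional (carrier X)" by (simp add: r_def)
  next
    fix x z assume xz: "x \<in> carrier X" "z \<in> carrier X"
    have "r (x \<oplus> z) \<le> v s x + v t z" if st: "0 \<le> s" "0 \<le> t" for s t
    proof -
      have "(x \<oplus> z) \<oplus> of_real (s + t) \<odot> y = (x \<oplus> of_real s \<odot> y) \<oplus> (z \<oplus> of_real t \<odot> y)"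
        using xz y by (simp add: scale_left_distrib a_ac)
      then have "q ((x \<oplus> z) \<oplus> of_real (s + t) \<odot> y) \<le> q (x \<oplus> of_real s \<odot> y) + q (z \<oplus> of_real t \<odot> y)"
        using sublinear_functionals_add[OF q, of "x \<oplus> of_real s \<odot> y" "z \<oplus> of_real t \<odot> y"] xz y
        by simp
      then have "v (s + t) (x \<oplus> z) \<le> v s x + v t z"
        by (simp add: v_def algebra_simps)
      then show ?thesis
        using le[of "s + t" "x \<oplus> z"] xz st by simp
    qed
    then have "r (x \<oplus> z) - v t z \<le> r x" if "0 \<le> t" for t
      using that by (intro ge[OF xz(1)]) (simp add: algebra_simps)
    then have "r (x \<oplus> z) - r x \<le> r z"
      by (intro ge[OF xz(2)]) (simp add: algebra_simps)
    then show "r (x \<oplus> z) \<le> r x + r z" by simp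
  next
    fix c :: real and x assume c: "0 < c" and x: "x \<in> carrier X"
    have "r (of_real c \<odot> x) / c \<le> r x"
    proof (rule ge[OF x])
      fix t :: real assume t: "0 \<le> t"
      have "of_real c \<odot> x \<oplus> of_real (c * t) \<odot> y = of_real c \<odot> (x \<oplus> of_real t \<odot> y)"
        using x y by (simp add: scale_right_distrib scale_scale)
      then have "v (c * t) (of_real c \<odot> x) = c * v t x"
        using sublinear_functionals_scale[OF q _ c, of "x \<oplus> of_real t \<odot> y"] x y
        by (simp add: v_def algebra_simps)
      then show "r (of_real c \<odot> x) / c \<le> v t x"
        using le[of "c * t" "of_real c \<odot> x"] x c t by (simp add: field_simps)
    qed
    then show "r (of_real c \<odot> x) \<le> c * r x"
      using c by (simp add: field_simps)
  qed
  moreover have "r x \<le> q x" if "x \<in> carrier X" for x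
    using le[of 0 x] that y by (simp add: v_def)
  moreover have "r (\<ominus> y) \<le> - q y"
    using le[of 1 "\<ominus> y"] y sublinear_functionals_zero[OF q] by (simp add: v_def l_neg)
  ultimately show ?thesis by blast
qed

text \<open>
  Decreasing the norm at \<open>x0\<close> first and then passing to a minimal functional gives a sublinear
  \<open>f\<close> with \<open>f (- x0) \<le> - \<parallel>x0\<parallel>\<close>. By minimality \<open>f\<close> is odd, and an odd sublinear functional is linear.
\<close>

lemma real_hahn_banach_norming:
  assumes x0: "x0 \<in> carrier X"
  shows "\<exists>f. (\<forall>x\<in>carrier X. \<forall>y\<in>carrier X. f (x \<oplus> y) = f x + f y) \<and>
    (\<forall>c. \<forall>x\<in>carrier X. f (of_real c \<odot> x) = c * f x) \<and>
    (\<forall>x\<in>carrier X. f x \<le> vnorm X x) \<and> vnorm X x0 \<le> f x0"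
proof -
  have "(\<lambda>x\<in>carrier X. vnorm X x) \<in> sublinear_functionals X"
    by (auto simp: sublinear_functionals_def vnorm_triangle vnorm_smult)
  from exists_sublinear_functional_decreasing_at[OF this x0]
  obtain p where p: "p \<in> sublinear_functionals X"
    and p_le: "\<And>x. x \<in> carrier X \<Longrightarrow> p x \<le> vnorm X x" and p_x0: "p (\<ominus> x0) \<le> - vnorm X x0"
    using x0 by auto
  from exists_minimal_sublinear_functional[OF p]
  obtain f where f: "f \<in> sublinear_functionals X"
    and f_le: "\<And>x. x \<in> carrier X \<Longrightarrow> f x \<le> p x"
    and f_min: "\<And>r. r \<in> sublinear_functionals X \<Longrightarrow> (\<And>x. x \<in> carrier X \<Longrightarrow> r x \<le> f x) \<Longrightarrow> r = f"
    by blast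
  have odd: "f (\<ominus> x) = - f x" if x: "x \<in> carrier X" for x
  proof (rule antisym)
    obtain r where "r \<in> sublinear_functionals X" "\<forall>x\<in>carrier X. r x \<le> f x" "r (\<ominus> x) \<le> - f x"
      using exists_sublinear_functional_decreasing_at[OF f x] by blast
    then show "f (\<ominus> x) \<le> - f x" using f_min[of r] by simp
    show "- f x \<le> f (\<ominus> x)" using sublinear_functionals_minus[OF f x] by simp
  qed
  have "f (x \<oplus> y) = f x + f y" if xy: "x \<in> carrier X" "y \<in> carrier X" for x y
  proof (rule antisym)
    show "f (x \<oplus> y) \<le> f x + f y" by (rule sublinear_functionals_add[OF f xy])
    have "f (\<ominus> x \<oplus> \<ominus> y) \<le> f (\<ominus> x) + f (\<ominus> y)"
      using xy by (intro sublinear_functionals_add[OF f]) auto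
    then show "f x + f y \<le> f (x \<oplus> y)"
      using xy by (simp add: odd flip: minus_add)
  qed
  moreover have "f (of_real c \<odot> x) = c * f x" if x: "x \<in> carrier X" for c x
  proof -
    consider "0 < c" | "c = 0" | "c < 0" by linarith
    then show ?thesis
    proof cases
      case 1
      then show ?thesis using sublinear_functionals_scale[OF f x] by simp
    next
      case 2
      then show ?thesis using sublinear_functionals_zero[OF f] x by simp
    next
      case 3
      have "of_real c \<odot> x = \<ominus> (of_real (- c) \<odot> x)"
        using x by (simp add: scale_scale flip: scale_minus_one)
      then show ?thesis
        using sublinear_functionals_scale[OF f x, of "- c"] odd[of "of_real (- c) \<odot> x"] x 3 by simp
    qed
  qed
  moreover have "f x \<le> vnorm X x" if "x \<in> carrier X" for x
    using f_le p_le that order_trans by blast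
  moreover have "vnorm X x0 \<le> f x0"
    using f_le[of "\<ominus> x0"] p_x0 odd[OF x0] x0 by simp
  ultimately show ?thesis by blast
qed

end

section \<open>The Hahn-Banach theorem for real or complex scalars\<close>

text \<open>
  A common description of both fields, with \<open>\<rho>\<close> the real part: \<open>\<iota>\<close> is an imaginary unit in the
  complex case and zero in the real case, so that every scalar has the form \<open>s + \<iota> t\<close> and the
  complexification of a real functional is given by one formula for both fields.
\<close>

lemma real_or_complex_imaginary_unit:
  "\<exists>(\<iota> :: 'k::real_or_complex) \<rho>. (\<iota> = 0 \<or> \<iota> * \<iota> = - 1) \<and> (\<forall>a. \<exists>s t. a = of_real s + \<iota> * of_real t) \<and>
     (\<forall>s t. \<rho> (of_real s + \<iota> * of_real t) = s) \<and>
     (\<forall>a. \<rho> a \<le> norm a) \<and> (\<forall>a. \<rho> a = norm a \<longrightarrow> a = of_real (norm a))"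
proof -
  obtain \<phi> :: "'k \<Rightarrow> complex" where
    add: "\<And>a b. \<phi> (a + b) = \<phi> a + \<phi> b" and mult: "\<And>a b. \<phi> (a * b) = \<phi> a * \<phi> b" and
    re: "\<And>r. \<phi> (r *\<^sub>R 1) = complex_of_real r" and norm: "\<And>a. norm (\<phi> a) = norm a" and
    range: "range \<phi> = \<real> \<or> range \<phi> = UNIV"
    using real_or_complex by blast
  have of_real: "\<phi> (of_real r) = of_real r" for r
    by (simp add: of_real_def re flip: scaleR_conv_of_real)
  have inj: "a = b" if "\<phi> a = \<phi> b" for a b
  proof -
    have "\<phi> (a - b) = 0" using add[of "a - b" b] that by simp
    then have "norm (a - b) = 0" by (simp flip: norm)
    then show ?thesis by simp
  qed
  have "\<exists>\<iota> :: 'k. (\<iota> = 0 \<or> \<iota> * \<iota> = - 1) \<and> (\<forall>a. \<exists>s t. a = of_real s + \<iota> * of_real t) \<and> Re (\<phi> \<iota>) = 0"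
    using range
  proof
    assume R: "range \<phi> = \<real>"
    have "\<exists>s. a = of_real s" for a :: 'k
    proof -
      have "\<phi> a \<in> \<real>" using R by auto
      then obtain s where "\<phi> a = of_real s" by (auto elim: Reals_cases)
      then have "a = of_real s" by (intro inj) (simp add: of_real)
      then show ?thesis by blast
    qed
    moreover have "\<phi> 0 = 0" using of_real[of 0] by simp
    ultimately show ?thesis by (intro exI[of _ 0]) simp
  next
    assume R: "range \<phi> = UNIV"
    then obtain \<iota> where \<iota>: "\<phi> \<iota> = \<i>" by (metis surj_def)
    have "\<phi> (\<iota> * \<iota>) = \<phi> (of_real (- 1))" by (simp only: mult \<iota> of_real) simp
    then have "\<iota> * \<iota> = - 1" by (auto dest: inj)
    moreover have "a = of_real (Re (\<phi> a)) + \<iota> * of_real (Im (\<phi> a))" for a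
      by (rule inj) (simp add: add mult of_real \<iota> flip: complex_eq)
    ultimately show ?thesis using \<iota> by (intro exI[of _ \<iota>]) auto
  qed
  then obtain \<iota> where \<iota>: "\<iota> = 0 \<or> \<iota> * \<iota> = - 1" "\<And>a. \<exists>s t. a = of_real s + \<iota> * of_real t" "Re (\<phi> \<iota>) = 0"
    by blast
  have "a = of_real (norm a)" if "Re (\<phi> a) = norm a" for a
  proof -
    have "(Re (\<phi> a))\<^sup>2 + (Im (\<phi> a))\<^sup>2 = (Re (\<phi> a))\<^sup>2"
      using cmod_power2[of "\<phi> a"] that by (simp add: norm)
    then have "\<phi> a = \<phi> (of_real (norm a))"
      using that by (simp add: of_real complex_eq_iff)
    then show ?thesis by (rule inj)
  qed
  moreover have "Re (\<phi> a) \<le> norm a" for a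
    using complex_Re_le_cmod[of "\<phi> a"] by (simp add: norm)
  ultimately show ?thesis
    using \<iota> by (intro exI[of _ \<iota>] exI[of _ "\<lambda>a. Re (\<phi> a)"]) (auto simp: add mult of_real)
qed

lemma dual_space_simps [simp]:
  "\<zero>\<^bsub>dual_space X\<^esub> = (\<lambda>x\<in>carrier X. 0)"
  "f \<oplus>\<^bsub>dual_space X\<^esub> g = (\<lambda>x\<in>carrier X. f x + g x)"
  "c \<odot>\<^bsub>dual_space X\<^esub> f = (\<lambda>x\<in>carrier X. c * f x)"
  by (simp_all add: dual_space_def)

lemma dual_space_carrierI:
  assumes "f \<in> extensional (carrier X)"
    and "\<And>x y. \<lbrakk>x \<in> carrier X; y \<in> carrier X\<rbrakk> \<Longrightarrow> f (x \<oplus>\<^bsub>X\<^esub> y) = f x + f y"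
    and "\<And>c x. x \<in> carrier X \<Longrightarrow> f (c \<odot>\<^bsub>X\<^esub> x) = c * f x"
    and "\<And>x. x \<in> carrier X \<Longrightarrow> norm (f x) \<le> C * vnorm X x"
  shows "f \<in> carrier (dual_space X)"
  using assms by (auto simp: dual_space_def intro!: exI[of _ C])

lemma dual_space_carrierD:
  assumes "f \<in> carrier (dual_space X)"
  shows "f \<in> extensional (carrier X)"
    and "\<lbrakk>x \<in> carrier X; y \<in> carrier X\<rbrakk> \<Longrightarrow> f (x \<oplus>\<^bsub>X\<^esub> y) = f x + f y"
    and "x \<in> carrier X \<Longrightarrow> f (c \<odot>\<^bsub>X\<^esub> x) = c * f x"
    and "\<exists>C. \<forall>x\<in>carrier X. norm (f x) \<le> C * vnorm X x"
  using assms by (auto simp: dual_space_def)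

text \<open>
  The usual complexification \<open>F x = f x - \<iota> f (\<iota> x)\<close> of the real functional \<open>f\<close>, whose real part is
  \<open>f\<close>. Rotating \<open>x\<close> so that \<open>F x\<close> becomes a nonnegative real number bounds \<open>|F x|\<close> by the norm.
\<close>

lemma (in normed_space) hahn_banach_norming:
  assumes x0: "x0 \<in> carrier X"
  shows "\<exists>F\<in>carrier (dual_space X). (\<forall>x\<in>carrier X. norm (F x) \<le> vnorm X x) \<and>
    F x0 = of_real (vnorm X x0)"
proof -
  obtain f where f_add: "\<And>x y. \<lbrakk>x \<in> carrier X; y \<in> carrier X\<rbrakk> \<Longrightarrow> f (x \<oplus> y) = f x + f y"
    and f_scale: "\<And>c x. x \<in> carrier X \<Longrightarrow> f (of_real c \<odot> x) = c * f x"
    and f_le: "\<And>x. x \<in> carrier X \<Longrightarrow> f x \<le> vnorm X x"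
    and f_x0: "vnorm X x0 \<le> f x0"
    using real_hahn_banach_norming[OF x0] by blast
  obtain \<iota> :: 'k and \<rho> where \<iota>: "\<iota> = 0 \<or> \<iota> * \<iota> = - 1"
    and split: "\<And>a. \<exists>s t. a = of_real s + \<iota> * of_real t"
    and \<rho>: "\<And>s t. \<rho> (of_real s + \<iota> * of_real t) = s"
    and \<rho>_le: "\<And>a. \<rho> a \<le> norm a"
    and \<rho>_eq: "\<And>a. \<rho> a = norm a \<Longrightarrow> a = of_real (norm a)"
    using real_or_complex_imaginary_unit by blast
  define F where "F x = of_real (f x) + \<iota> * of_real (- f (\<iota> \<odot> x))" for x
  have \<rho>_F: "\<rho> (F x) = f x" for x
    by (simp only: F_def \<rho>)
  have F_add: "F (x \<oplus> y) = F x + F y" if "x \<in> carrier X" "y \<in> carrier X" for x y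
    using that by (simp add: F_def f_add scale_right_distrib algebra_simps)
  have F_real: "F (of_real c \<odot> x) = of_real c * F x" if "x \<in> carrier X" for c x
  proof -
    have "\<iota> \<odot> (of_real c \<odot> x) = of_real c \<odot> (\<iota> \<odot> x)"
      using that by (simp add: scale_scale mult.commute)
    then show ?thesis
      using that by (simp add: F_def f_scale algebra_simps)
  qed
  have F_\<iota>: "F (\<iota> \<odot> x) = \<iota> * F x" if x: "x \<in> carrier X" for x
    using \<iota>
  proof
    assume "\<iota> = 0"
    then show ?thesis using f_scale[of x 0] x by (simp add: F_def)
  next
    assume sq: "\<iota> * \<iota> = - 1"
    then have "\<iota> \<odot> (\<iota> \<odot> x) = of_real (- 1) \<odot> x"
      using x by (simp add: scale_scale)
    then have "f (\<iota> \<odot> (\<iota> \<odot> x)) = - f x"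
      using f_scale[OF x, of "- 1"] by simp
    moreover have "\<iota> * (\<iota> * a) = - a" for a
      by (simp add: mult.assoc[symmetric] sq)
    ultimately show ?thesis
      by (simp add: F_def distrib_left right_diff_distrib)
  qed
  have F_scale: "F (a \<odot> x) = a * F x" if x: "x \<in> carrier X" for a x
  proof -
    obtain s t where a: "a = of_real s + \<iota> * of_real t" using split by blast
    have "a \<odot> x = of_real s \<odot> x \<oplus> \<iota> \<odot> (of_real t \<odot> x)"
      using x by (simp add: a scale_left_distrib scale_scale)
    then show ?thesis
      using x by (simp add: F_add F_real F_\<iota> a algebra_simps)
  qed
  have F_le: "norm (F x) \<le> vnorm X x" if x: "x \<in> carrier X" for x
  proof (cases "F x = 0")
    case False
    define c where "c = of_real (norm (F x)) / F x"
    have "F (c \<odot> x) = of_real (norm (F x))"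
      using False by (simp add: F_scale[OF x] c_def)
    then have "norm (F x) = f (c \<odot> x)"
      using \<rho>_F[of "c \<odot> x"] \<rho>[of "norm (F x)" 0] by simp
    also have "\<dots> \<le> vnorm X (c \<odot> x)"
      using x by (intro f_le) simp
    also have "\<dots> = vnorm X x"
      using False x by (simp add: vnorm_smult c_def norm_divide)
    finally show ?thesis .
  qed (use x in simp)
  \<comment> \<open>The bounds \<open>\<parallel>x0\<parallel> \<le> f x0 = \<rho> (F x0) \<le> |F x0| \<le> \<parallel>x0\<parallel>\<close> are all equalities, so \<open>F x0\<close> is its own modulus.\<close>
  have "\<rho> (F x0) = norm (F x0)" "norm (F x0) = vnorm X x0"
    using \<rho>_F[of x0] \<rho>_le[of "F x0"] F_le[OF x0] f_x0 by linarith+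
  then have "F x0 = of_real (vnorm X x0)"
    using \<rho>_eq[of "F x0"] by simp
  moreover have "restrict F (carrier X) \<in> carrier (dual_space X)"
    by (rule dual_space_carrierI[where C = 1]) (auto simp: F_add F_scale F_le)
  ultimately show ?thesis
    using x0 F_le by (intro bexI[of _ "restrict F (carrier X)"]) auto
qed

section \<open>Dual spaces and weakly null sequences of functionals\<close>

context normed_space
begin

lemma dual_space_vnorm_le:
  assumes "0 \<le> C" "\<And>x. x \<in> carrier X \<Longrightarrow> norm (f x) \<le> C * vnorm X x"
  shows "vnorm (dual_space X) f \<le> C"
  unfolding dual_space_def normed_module.simps
proof (rule cSUP_least)
  show "{x \<in> carrier X. vnorm X x \<le> 1} \<noteq> {}"
    by (auto intro!: exI[of _ \<zero>])
next
  fix x assume "x \<in> {x \<in> carrier X. vnorm X x \<le> 1}"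
  then show "norm (f x) \<le> C"
    using assms(2)[of x] mult_left_le[of "vnorm X x" C] assms(1) by simp
qed

lemma norm_le_dual_space_vnorm:
  assumes f: "f \<in> carrier (dual_space X)" and x: "x \<in> carrier X" "vnorm X x \<le> 1"
  shows "norm (f x) \<le> vnorm (dual_space X) f"
  unfolding dual_space_def normed_module.simps
proof (rule cSUP_upper)
  obtain C where C: "\<And>y. y \<in> carrier X \<Longrightarrow> norm (f y) \<le> C * vnorm X y"
    using dual_space_carrierD(4)[OF f] by blast
  show "bdd_above ((\<lambda>x. norm (f x)) ` {x \<in> carrier X. vnorm X x \<le> 1})"
  proof (rule bdd_aboveI2)
    fix y assume y: "y \<in> {x \<in> carrier X. vnorm X x \<le> 1}"
    then have "C * vnorm X y \<le> \<bar>C\<bar> * 1"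
      by (intro mult_mono) auto
    then show "norm (f y) \<le> \<bar>C\<bar>" using C[of y] y by simp
  qed
qed (use x in simp)

lemma dual_space_vnorm_nonneg:
  "f \<in> carrier (dual_space X) \<Longrightarrow> 0 \<le> vnorm (dual_space X) f"
  by (rule order_trans[OF norm_ge_zero norm_le_dual_space_vnorm[of f \<zero>]]) auto

lemma dual_space_apply_le:
  assumes f: "f \<in> carrier (dual_space X)" and x: "x \<in> carrier X"
  shows "norm (f x) \<le> vnorm (dual_space X) f * vnorm X x"
proof (cases "vnorm X x = 0")
  case True
  then have "x = 0 \<odot> x" using x by (simp add: vnorm_eq_0_iff)
  then have "f x = 0" using dual_space_carrierD(3)[OF f x, of 0] by simp
  then show ?thesis using True by simp
next
  case False
  then have pos: "0 < vnorm X x" using vnorm_nonneg[OF x] by simp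
  have "norm (f (of_real (inverse (vnorm X x)) \<odot> x)) \<le> vnorm (dual_space X) f"
    using x pos by (intro norm_le_dual_space_vnorm[OF f]) (auto simp: vnorm_smult norm_inverse)
  then show ?thesis
    using x pos by (simp add: dual_space_carrierD(3)[OF f] norm_mult norm_inverse norm_divide field_simps)
qed

lemma dual_space_zero_closed: "(\<lambda>x\<in>carrier X. 0) \<in> carrier (dual_space X)"
  by (rule dual_space_carrierI[where C = 0]) auto

lemma dual_space_add_closed:
  assumes f: "f \<in> carrier (dual_space X)" and g: "g \<in> carrier (dual_space X)"
  shows "f \<oplus>\<^bsub>dual_space X\<^esub> g \<in> carrier (dual_space X)"
proof (rule dual_space_carrierI)
  fix x assume x: "x \<in> carrier X"
  show "norm ((f \<oplus>\<^bsub>dual_space X\<^esub> g) x) \<le> (vnorm (dual_space X) f + vnorm (dual_space X) g) * vnorm X x"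
    using dual_space_apply_le[OF f x] dual_space_apply_le[OF g x] norm_triangle_ineq[of "f x" "g x"] x
    by (simp add: algebra_simps)
qed (auto simp: dual_space_carrierD(2,3)[OF f] dual_space_carrierD(2,3)[OF g] algebra_simps)

lemma dual_space_smult_closed:
  assumes f: "f \<in> carrier (dual_space X)"
  shows "c \<odot>\<^bsub>dual_space X\<^esub> f \<in> carrier (dual_space X)"
proof (rule dual_space_carrierI)
  fix x assume x: "x \<in> carrier X"
  show "norm ((c \<odot>\<^bsub>dual_space X\<^esub> f) x) \<le> (norm c * vnorm (dual_space X) f) * vnorm X x"
    using mult_left_mono[OF dual_space_apply_le[OF f x], of "norm c"] x
    by (simp add: norm_mult algebra_simps)
qed (auto simp: dual_space_carrierD(2,3)[OF f] algebra_simps)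

lemma dual_space_eqI:
  assumes "f \<in> carrier (dual_space X)" "g \<in> carrier (dual_space X)"
    "\<And>x. x \<in> carrier X \<Longrightarrow> f x = g x"
  shows "f = g"
  using assms dual_space_carrierD(1) by (blast intro: extensionalityI)

lemma cring_scalars: "cring (scalars :: 'k ring)"
  by (rule R.is_cring)

lemma normed_space_dual_space: "normed_space (dual_space X)"
proof -
  have group: "abelian_group (dual_space X)"
  proof (rule abelian_groupI)
    fix f g h assume fgh: "f \<in> carrier (dual_space X)" "g \<in> carrier (dual_space X)"
      "h \<in> carrier (dual_space X)"
    show "f \<oplus>\<^bsub>dual_space X\<^esub> g \<oplus>\<^bsub>dual_space X\<^esub> h = f \<oplus>\<^bsub>dual_space X\<^esub> (g \<oplus>\<^bsub>dual_space X\<^esub> h)"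
      by (auto simp: add.assoc)
  next
    fix f assume f: "f \<in> carrier (dual_space X)"
    show "\<exists>g\<in>carrier (dual_space X). g \<oplus>\<^bsub>dual_space X\<^esub> f = \<zero>\<^bsub>dual_space X\<^esub>"
      by (rule bexI[OF _ dual_space_smult_closed[OF f, of "- 1"]]) auto
    show "\<zero>\<^bsub>dual_space X\<^esub> \<oplus>\<^bsub>dual_space X\<^esub> f = f"
      using f dual_space_carrierD(1)[OF f] by (auto intro: extensionalityI)
  qed (use dual_space_zero_closed in \<open>auto simp: dual_space_add_closed add.commute
    simp del: dual_space_simps(2)\<close>, auto simp: add.commute)
  have module: "module scalars (dual_space X)"
  proof (rule moduleI[OF cring_scalars group])
    fix f assume f: "f \<in> carrier (dual_space X)"
    show "\<one>\<^bsub>scalars\<^esub> \<odot>\<^bsub>dual_space X\<^esub> f = f"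
      using dual_space_carrierD(1)[OF f] by (auto intro: extensionalityI)
  qed (auto simp: dual_space_smult_closed distrib_left distrib_right mult.assoc
      simp del: dual_space_simps(3), auto simp: distrib_left distrib_right mult.assoc)
  show ?thesis
  proof (intro normed_space.intro module normed_space_axioms.intro)
    fix f assume f: "f \<in> carrier (dual_space X)"
    show "vnorm (dual_space X) f = 0 \<longleftrightarrow> f = \<zero>\<^bsub>dual_space X\<^esub>"
    proof
      assume "vnorm (dual_space X) f = 0"
      then show "f = \<zero>\<^bsub>dual_space X\<^esub>"
        using dual_space_apply_le[OF f] dual_space_zero_closed
        by (intro dual_space_eqI[OF f]) auto
    next
      assume "f = \<zero>\<^bsub>dual_space X\<^esub>"
      then show "vnorm (dual_space X) f = 0"
        using dual_space_vnorm_le[of 0 f] dual_space_vnorm_nonneg[OF f] by simp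
    qed
    fix g assume g: "g \<in> carrier (dual_space X)"
    show "vnorm (dual_space X) (f \<oplus>\<^bsub>dual_space X\<^esub> g) \<le> vnorm (dual_space X) f + vnorm (dual_space X) g"
    proof (rule dual_space_vnorm_le)
      fix x assume x: "x \<in> carrier X"
      show "norm ((f \<oplus>\<^bsub>dual_space X\<^esub> g) x) \<le> (vnorm (dual_space X) f + vnorm (dual_space X) g) * vnorm X x"
        using dual_space_apply_le[OF f x] dual_space_apply_le[OF g x]
          norm_triangle_ineq[of "f x" "g x"] x by (simp add: algebra_simps)
    qed (use dual_space_vnorm_nonneg f g in auto)
  next
    fix f c assume f: "f \<in> carrier (dual_space X)"
    have le: "vnorm (dual_space X) (c \<odot>\<^bsub>dual_space X\<^esub> f) \<le> norm c * vnorm (dual_space X) f"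
      if f: "f \<in> carrier (dual_space X)" for c f
    proof (rule dual_space_vnorm_le)
      fix x assume x: "x \<in> carrier X"
      show "norm ((c \<odot>\<^bsub>dual_space X\<^esub> f) x) \<le> (norm c * vnorm (dual_space X) f) * vnorm X x"
        using mult_left_mono[OF dual_space_apply_le[OF f x], of "norm c"] x
        by (simp add: norm_mult algebra_simps)
    qed (use dual_space_vnorm_nonneg f in auto)
    show "vnorm (dual_space X) (c \<odot>\<^bsub>dual_space X\<^esub> f) = norm c * vnorm (dual_space X) f"
    proof (cases "c = 0")
      case True
      then show ?thesis
        using le[OF f, of c] dual_space_vnorm_nonneg[OF dual_space_smult_closed[OF f, of c]]
        by simp
    next
      case False
      have "f = inverse c \<odot>\<^bsub>dual_space X\<^esub> (c \<odot>\<^bsub>dual_space X\<^esub> f)"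
        using False dual_space_carrierD(1)[OF f] by (auto intro: extensionalityI)
      then have "vnorm (dual_space X) f \<le> norm (inverse c) * vnorm (dual_space X) (c \<odot>\<^bsub>dual_space X\<^esub> f)"
        using le[OF dual_space_smult_closed[OF f, of c], of "inverse c"] by metis
      then have "norm c * vnorm (dual_space X) f \<le> vnorm (dual_space X) (c \<odot>\<^bsub>dual_space X\<^esub> f)"
        using False by (simp add: norm_divide field_simps)
      then show ?thesis using le[OF f, of c] by linarith
    qed
  qed
qed

text \<open>
  A weakly unconditionally Cauchy series has weakly null terms. The hypothesis bounds the norm of
  every combination \<open>\<Sum>\<^sub>j c\<^sub>j g\<^sub>j\<close> with \<open>|c\<^sub>j| \<le> 1\<close> by \<open>B\<close>; for a functional \<open>\<phi>\<close> on the dual space, choosing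
  the phases \<open>c\<^sub>j\<close> such that \<open>c\<^sub>j \<phi>(g\<^sub>j) = |\<phi>(g\<^sub>j)|\<close> bounds the partial sums of \<open>\<Sum>\<^sub>j |\<phi>(g\<^sub>j)|\<close>.
\<close>

lemma weakly_null_dual_spaceI:
  assumes g: "\<And>j. g j \<in> carrier (dual_space X)" and "0 \<le> B"
    and sum_le: "\<And>x N. x \<in> carrier X \<Longrightarrow> (\<Sum>j<N. norm (g j x)) \<le> B * vnorm X x"
  shows "weakly_null (dual_space X) g"
  unfolding weakly_null_def
proof (intro conjI allI ballI g)
  fix \<phi> assume \<phi>: "\<phi> \<in> carrier (dual_space (dual_space X))"
  obtain D where D: "\<And>f. f \<in> carrier (dual_space X) \<Longrightarrow> norm (\<phi> f) \<le> D * vnorm (dual_space X) f"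
    using dual_space_carrierD(4)[OF \<phi>] by blast
  define c where "c j = of_real (norm (\<phi> (g j))) / \<phi> (g j)" for j
  have c: "norm (c j) \<le> 1" "c j * \<phi> (g j) = of_real (norm (\<phi> (g j)))" for j
    by (cases "\<phi> (g j) = 0"; simp add: c_def norm_divide)+
  define h where "h N = (\<lambda>x\<in>carrier X. \<Sum>j<N. c j * g j x)" for N
  have h_Suc: "h (Suc N) = h N \<oplus>\<^bsub>dual_space X\<^esub> c N \<odot>\<^bsub>dual_space X\<^esub> g N" for N
    by (auto simp: h_def)
  have h_0: "h 0 = \<zero>\<^bsub>dual_space X\<^esub>"
    by (simp add: h_def)
  have h: "h N \<in> carrier (dual_space X)" for N
  proof (induction N)
    case 0
    show ?case unfolding h_0 dual_space_simps by (rule dual_space_zero_closed)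
  next
    case (Suc N)
    then show ?case unfolding h_Suc by (intro dual_space_add_closed dual_space_smult_closed g)
  qed
  have "\<phi> (h N) = of_real (\<Sum>j<N. norm (\<phi> (g j)))" for N
  proof (induction N)
    case 0
    have "h 0 = h 0 \<oplus>\<^bsub>dual_space X\<^esub> h 0" by (auto simp: h_def)
    then have "\<phi> (h 0) = \<phi> (h 0) + \<phi> (h 0)"
      using dual_space_carrierD(2)[OF \<phi> h h, of 0 0] by simp
    then show ?case by simp
  next
    case (Suc N)
    have "\<phi> (h (Suc N)) = \<phi> (h N) + c N * \<phi> (g N)"
      unfolding h_Suc using dual_space_carrierD(2)[OF \<phi> h[of N] dual_space_smult_closed[OF g[of N]]]
        dual_space_carrierD(3)[OF \<phi> g] by simp
    then show ?case by (simp add: Suc c)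
  qed
  then have "(\<Sum>j<N. norm (\<phi> (g j))) = norm (\<phi> (h N))" for N
    by (simp add: sum_nonneg del: of_real_sum)
  also have "norm (\<phi> (h N)) \<le> \<bar>D\<bar> * B" for N
  proof -
    have "vnorm (dual_space X) (h N) \<le> B"
    proof (rule dual_space_vnorm_le[OF \<open>0 \<le> B\<close>])
      fix x assume x: "x \<in> carrier X"
      have "norm (h N x) \<le> (\<Sum>j<N. norm (c j * g j x))"
        using x by (simp add: h_def norm_sum)
      also have "\<dots> \<le> (\<Sum>j<N. norm (g j x))"
        using c(1) by (intro sum_mono) (simp add: norm_mult mult_left_le_one_le)
      also have "\<dots> \<le> B * vnorm X x" by (rule sum_le[OF x])
      finally show "norm (h N x) \<le> B * vnorm X x" .
    qed
    then have "D * vnorm (dual_space X) (h N) \<le> \<bar>D\<bar> * B"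
      using dual_space_vnorm_nonneg[OF h] by (intro mult_mono) auto
    then show ?thesis using D[OF h, of N] by linarith
  qed
  finally have "summable (\<lambda>j. norm (\<phi> (g j)))"
    by (intro summableI_nonneg_bounded) auto
  then show "(\<lambda>j. \<phi> (g j)) \<longlonglongrightarrow> 0"
    using summable_LIMSEQ_zero tendsto_norm_zero_iff by blast
qed

end

section \<open>Bounded operators\<close>

definition bounded_operator ::
    "('k::real_or_complex, 'a) normed_module \<Rightarrow> ('k, 'b) normed_module \<Rightarrow> ('a \<Rightarrow> 'b) \<Rightarrow> bool" where
  "bounded_operator X Y T \<longleftrightarrow>
     (\<forall>x\<in>carrier X. T x \<in> carrier Y) \<and>
     (\<forall>x\<in>carrier X. \<forall>y\<in>carrier X. T (x \<oplus>\<^bsub>X\<^esub> y) = T x \<oplus>\<^bsub>Y\<^esub> T y) \<and>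
     (\<forall>c. \<forall>x\<in>carrier X. T (c \<odot>\<^bsub>X\<^esub> x) = c \<odot>\<^bsub>Y\<^esub> T x) \<and>
     (\<exists>C\<ge>0. \<forall>x\<in>carrier X. vnorm Y (T x) \<le> C * vnorm X x)"

definition adjoint ::
    "('k::real_or_complex, 'a) normed_module \<Rightarrow> ('a \<Rightarrow> 'b) \<Rightarrow> ('b \<Rightarrow> 'k) \<Rightarrow> 'a \<Rightarrow> 'k" where
  "adjoint X T f = (\<lambda>x\<in>carrier X. f (T x))"

lemma adjoint_in_dual_space:
  assumes "normed_space X" "normed_space Y" and T: "bounded_operator X Y T"
    and f: "f \<in> carrier (dual_space Y)"
  shows "adjoint X T f \<in> carrier (dual_space X)"
proof -
  interpret X: normed_space X by fact
  interpret Y: normed_space Y by fact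
  obtain C where C: "0 \<le> C" "\<And>x. x \<in> carrier X \<Longrightarrow> vnorm Y (T x) \<le> C * vnorm X x"
    using T by (auto simp: bounded_operator_def)
  show ?thesis
  proof (rule dual_space_carrierI)
    fix x assume x: "x \<in> carrier X"
    then have "norm (f (T x)) \<le> vnorm (dual_space Y) f * vnorm Y (T x)"
      using T by (intro Y.dual_space_apply_le[OF f]) (simp add: bounded_operator_def)
    also have "\<dots> \<le> vnorm (dual_space Y) f * (C * vnorm X x)"
      by (intro mult_left_mono C(2)[OF x] Y.dual_space_vnorm_nonneg[OF f])
    finally show "norm (adjoint X T f x) \<le> (vnorm (dual_space Y) f * C) * vnorm X x"
      using x by (simp add: adjoint_def mult.assoc)
  qed (use T in \<open>auto simp: adjoint_def bounded_operator_def dual_space_carrierD(2,3)[OF f]\<close>)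
qed

lemma bounded_operator_adjoint:
  assumes "normed_space X" "normed_space Y" and T: "bounded_operator X Y T"
  shows "bounded_operator (dual_space Y) (dual_space X) (adjoint X T)"
proof -
  interpret X: normed_space X by fact
  interpret Y: normed_space Y by fact
  obtain C where C: "0 \<le> C" "\<And>x. x \<in> carrier X \<Longrightarrow> vnorm Y (T x) \<le> C * vnorm X x"
    using T by (auto simp: bounded_operator_def)
  have TY: "T x \<in> carrier Y" if "x \<in> carrier X" for x
    using T that by (simp add: bounded_operator_def)
  have "vnorm (dual_space X) (adjoint X T f) \<le> C * vnorm (dual_space Y) f"
    if f: "f \<in> carrier (dual_space Y)" for f
  proof (rule X.dual_space_vnorm_le)
    show "0 \<le> C * vnorm (dual_space Y) f"
      using C(1) Y.dual_space_vnorm_nonneg[OF f] by simp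
    fix x assume x: "x \<in> carrier X"
    have "norm (f (T x)) \<le> vnorm (dual_space Y) f * vnorm Y (T x)"
      by (rule Y.dual_space_apply_le[OF f TY[OF x]])
    also have "\<dots> \<le> vnorm (dual_space Y) f * (C * vnorm X x)"
      by (intro mult_left_mono C(2)[OF x] Y.dual_space_vnorm_nonneg[OF f])
    finally show "norm (adjoint X T f x) \<le> (C * vnorm (dual_space Y) f) * vnorm X x"
      using x by (simp add: adjoint_def algebra_simps)
  qed
  then show ?thesis
    using adjoint_in_dual_space[OF assms] C(1) TY
    by (auto simp: bounded_operator_def adjoint_def fun_eq_iff)
qed

lemma weakly_null_bounded_operator:
  assumes "normed_space X" "normed_space Y" "bounded_operator X Y T" "weakly_null X x"
  shows "weakly_null Y (\<lambda>n. T (x n))"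
  unfolding weakly_null_def
proof (intro conjI allI ballI)
  show "T (x n) \<in> carrier Y" for n
    using assms by (simp add: weakly_null_def bounded_operator_def)
  fix f assume "f \<in> carrier (dual_space Y)"
  then have "(\<lambda>n. adjoint X T f (x n)) \<longlonglongrightarrow> 0"
    using adjoint_in_dual_space[OF assms(1-3)] assms(4) by (simp add: weakly_null_def)
  then show "(\<lambda>n. f (T (x n))) \<longlonglongrightarrow> 0"
    using assms(4) by (simp add: weakly_null_def adjoint_def)
qed

lemma weakly_p_summable_bounded_operator:
  assumes "normed_space X" "normed_space Y" "bounded_operator X Y T" "weakly_p_summable p X x"
  shows "weakly_p_summable p Y (\<lambda>n. T (x n))"
  unfolding weakly_p_summable_def
proof (intro conjI allI ballI)
  show "T (x n) \<in> carrier Y" for n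
    using assms by (simp add: weakly_p_summable_def bounded_operator_def)
  fix f assume "f \<in> carrier (dual_space Y)"
  then have "summable (\<lambda>n. norm (adjoint X T f (x n)) powr p)"
    using adjoint_in_dual_space[OF assms(1-3)] assms(4) by (simp add: weakly_p_summable_def)
  then show "summable (\<lambda>n. norm (f (T (x n))) powr p)"
    using assms(4) by (simp add: weakly_p_summable_def adjoint_def)
qed

text \<open>
  The adjoint is a bounded operator between the dual spaces, so it maps a weakly null sequence of
  functionals on \<open>Y\<close> to one on \<open>X\<close>; uniform convergence of the latter on \<open>K\<close> is uniform convergence
  of the former on the image of \<open>K\<close>.
\<close>

lemma dunford_pettis_set_bounded_operator:
  assumes X: "normed_space X" and Y: "normed_space Y" and T: "bounded_operator X Y T"
    and K: "dunford_pettis_set X K"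
  shows "dunford_pettis_set Y (T ` K)"
  unfolding dunford_pettis_set_def
proof (intro conjI allI impI)
  have KX: "K \<subseteq> carrier X" using K by (simp add: dunford_pettis_set_def)
  then show "T ` K \<subseteq> carrier Y" using T by (auto simp: bounded_operator_def)
  obtain C where C: "0 \<le> C" "\<And>x. x \<in> carrier X \<Longrightarrow> vnorm Y (T x) \<le> C * vnorm X x"
    using T by (auto simp: bounded_operator_def)
  obtain B where B: "\<And>x. x \<in> K \<Longrightarrow> vnorm X x \<le> B"
    using K by (auto simp: dunford_pettis_set_def)
  have "vnorm Y (T x) \<le> C * B" if "x \<in> K" for x
    using C(2)[of x] mult_left_mono[OF B[OF that] C(1)] subsetD[OF KX that] by linarith
  then show "\<exists>B. \<forall>y\<in>T ` K. vnorm Y y \<le> B" by blast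
  fix f assume "weakly_null (dual_space Y) f"
  then have "weakly_null (dual_space X) (\<lambda>n. adjoint X T (f n))"
    by (rule weakly_null_bounded_operator[OF normed_space.normed_space_dual_space[OF Y]
          normed_space.normed_space_dual_space[OF X] bounded_operator_adjoint[OF X Y T]])
  then have "uniform_limit K (\<lambda>n. adjoint X T (f n)) (\<lambda>_. 0) sequentially"
    using K by (simp add: dunford_pettis_set_def)
  moreover have "adjoint X T (f n) x = f n (T x)" if "x \<in> K" for n x
    using subsetD[OF KX that] by (simp add: adjoint_def)
  ultimately show "uniform_limit (T ` K) f (\<lambda>_. 0) sequentially"
    by (simp add: uniform_limit_iff)
qed

section \<open>The \<open>\<ell>\<^sub>1\<close>-sum and its summands\<close>

lemma l1_sum_simps [simp]:
  "x \<in> carrier (l1_sum X) \<longleftrightarrow> (\<forall>n. x n \<in> carrier (X n)) \<and> summable (\<lambda>n. vnorm (X n) (x n))"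
  "\<zero>\<^bsub>l1_sum X\<^esub> = (\<lambda>n. \<zero>\<^bsub>X n\<^esub>)"
  "x \<oplus>\<^bsub>l1_sum X\<^esub> y = (\<lambda>n. x n \<oplus>\<^bsub>X n\<^esub> y n)"
  "c \<odot>\<^bsub>l1_sum X\<^esub> x = (\<lambda>n. c \<odot>\<^bsub>X n\<^esub> x n)"
  "vnorm (l1_sum X) x = (\<Sum>n. vnorm (X n) (x n))"
  by (simp_all add: l1_sum_def)

lemma normed_space_l1_sum:
  assumes "\<And>n. normed_space (X n)"
  shows "normed_space (l1_sum X)"
proof -
  interpret X: normed_space "X n" for n by fact
  have summable_add: "summable (\<lambda>n. vnorm (X n) (x n \<oplus>\<^bsub>X n\<^esub> y n))"
    if "x \<in> carrier (l1_sum X)" "y \<in> carrier (l1_sum X)" for x y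
  proof (rule summable_comparison_test')
    show "summable (\<lambda>n. vnorm (X n) (x n) + vnorm (X n) (y n))"
      using that by (simp add: summable_add)
    show "norm (vnorm (X n) (x n \<oplus>\<^bsub>X n\<^esub> y n)) \<le> vnorm (X n) (x n) + vnorm (X n) (y n)"
      if "0 \<le> n" for n
      using \<open>x \<in> _\<close> \<open>y \<in> _\<close> by (simp add: X.vnorm_triangle)
  qed
  have group: "abelian_group (l1_sum X)"
  proof (rule abelian_groupI)
    fix x assume x: "x \<in> carrier (l1_sum X)"
    show "\<exists>y\<in>carrier (l1_sum X). y \<oplus>\<^bsub>l1_sum X\<^esub> x = \<zero>\<^bsub>l1_sum X\<^esub>"
      using x by (intro bexI[of _ "\<lambda>n. \<ominus>\<^bsub>X n\<^esub> x n"]) (auto simp: X.l_neg)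
  qed (auto simp: summable_add X.a_ac fun_eq_iff)
  have module: "module scalars (l1_sum X)"
    by (rule moduleI[OF X.cring_scalars group])
      (auto simp: X.vnorm_smult X.scale_left_distrib X.scale_right_distrib X.scale_scale
        summable_mult fun_eq_iff)
  show ?thesis
  proof (intro normed_space.intro module normed_space_axioms.intro)
    fix x assume x: "x \<in> carrier (l1_sum X)"
    then have "(\<Sum>n. vnorm (X n) (x n)) = 0 \<longleftrightarrow> (\<forall>n. vnorm (X n) (x n) = 0)"
      by (intro suminf_eq_zero_iff) auto
    then show "vnorm (l1_sum X) x = 0 \<longleftrightarrow> x = \<zero>\<^bsub>l1_sum X\<^esub>"
      using x by (simp add: X.vnorm_eq_0_iff fun_eq_iff)
    show "vnorm (l1_sum X) (c \<odot>\<^bsub>l1_sum X\<^esub> x) = norm c * vnorm (l1_sum X) x" for c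
      using x by (simp add: X.vnorm_smult suminf_mult)
    fix y assume y: "y \<in> carrier (l1_sum X)"
    have "(\<Sum>n. vnorm (X n) (x n \<oplus>\<^bsub>X n\<^esub> y n)) \<le> (\<Sum>n. vnorm (X n) (x n) + vnorm (X n) (y n))"
      using x y by (intro suminf_le summable_add Series.summable_add) (auto simp: X.vnorm_triangle)
    then show "vnorm (l1_sum X) (x \<oplus>\<^bsub>l1_sum X\<^esub> y) \<le> vnorm (l1_sum X) x + vnorm (l1_sum X) y"
      using x y by (simp add: suminf_add)
  qed
qed

lemma sum_vnorm_le_l1_sum_vnorm:
  assumes "\<And>n. normed_space (X n)" "x \<in> carrier (l1_sum X)" "finite I"
  shows "(\<Sum>n\<in>I. vnorm (X n) (x n)) \<le> vnorm (l1_sum X) x"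
  using assms by (simp add: normed_space.vnorm_nonneg sum_le_suminf)

lemma bounded_operator_l1_sum_coordinate:
  assumes "\<And>n. normed_space (X n)"
  shows "bounded_operator (l1_sum X) (X k) (\<lambda>x. x k)"
proof -
  have "vnorm (X k) (x k) \<le> 1 * vnorm (l1_sum X) x" if "x \<in> carrier (l1_sum X)" for x
    using sum_vnorm_le_l1_sum_vnorm[where X = X, OF assms that, of "{k}"] by simp
  then show ?thesis
    unfolding bounded_operator_def by (intro conjI exI[of _ 1]) auto
qed

definition l1_sum_inclusion ::
    "(nat \<Rightarrow> ('k::real_or_complex, 'a) normed_module) \<Rightarrow> nat \<Rightarrow> 'a \<Rightarrow> nat \<Rightarrow> 'a" where
  "l1_sum_inclusion X k x = (\<lambda>n. if n = k then x else \<zero>\<^bsub>X n\<^esub>)"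

lemma l1_sum_inclusion_vnorm_sums:
  assumes "\<And>n. normed_space (X n)"
  shows "(\<lambda>n. vnorm (X n) (l1_sum_inclusion X k x n)) sums vnorm (X k) x"
proof -
  interpret X: normed_space "X n" for n by fact
  have "(\<lambda>n. vnorm (X n) (l1_sum_inclusion X k x n)) = (\<lambda>n. if n = k then vnorm (X k) x else 0)"
    by (auto simp: l1_sum_inclusion_def)
  then show ?thesis using sums_single[of k "\<lambda>_. vnorm (X k) x"] by simp
qed

lemma bounded_operator_l1_sum_inclusion:
  assumes "\<And>n. normed_space (X n)"
  shows "bounded_operator (X k) (l1_sum X) (l1_sum_inclusion X k)"
proof -
  interpret X: normed_space "X n" for n by fact
  have "l1_sum_inclusion X k x n \<in> carrier (X n)" if "x \<in> carrier (X k)" for x n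
    using that by (simp add: l1_sum_inclusion_def)
  moreover have "vnorm (l1_sum X) (l1_sum_inclusion X k x) \<le> 1 * vnorm (X k) x" for x
    using sums_unique[OF l1_sum_inclusion_vnorm_sums[where X = X, OF assms, of k x]] by simp
  moreover have "summable (\<lambda>n. vnorm (X n) (l1_sum_inclusion X k x n))" for x
    using sums_summable[OF l1_sum_inclusion_vnorm_sums[where X = X, OF assms, of k x]] .
  ultimately show ?thesis
    unfolding bounded_operator_def
    by (intro conjI exI[of _ 1]) (auto simp: l1_sum_inclusion_def fun_eq_iff)
qed

section \<open>Tails of Dunford-Pettis sets in an \<open>\<ell>\<^sub>1\<close>-sum\<close>

lemma sum_consecutive_blocks:
  fixes h :: "nat \<Rightarrow> real"
  assumes "a 0 = 0" "\<And>j. a j \<le> a (Suc j)"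
  shows "(\<Sum>j<N. \<Sum>k\<in>{a j..<a (Suc j)}. h k) = (\<Sum>k<a N. h k)"
proof (induction N)
  case (Suc N)
  then show ?case
    using sum.atLeastLessThan_concat[of 0 "a N" "a (Suc N)" h] assms(2)
    by (simp add: atLeast0LessThan)
qed (simp add: assms)

text \<open>
  The gliding hump argument: otherwise the block functionals \<open>g j\<close> built from norming functionals
  of the coordinates form a weakly null sequence that stays above \<open>e\<close> at the points \<open>y j\<close> of \<open>K\<close>.
\<close>

lemma dunford_pettis_set_l1_sum_tails:
  fixes X :: "nat \<Rightarrow> ('k::real_or_complex, 'a) normed_module"
  assumes X: "\<And>n. normed_space (X n)" and K: "dunford_pettis_set (l1_sum X) K" and "0 < e"
  shows "\<exists>a. \<forall>x\<in>K. \<forall>b. (\<Sum>k\<in>{a..<b}. vnorm (X k) (x k)) \<le> e"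
proof (rule ccontr)
  interpret X: normed_space "X n" for n by (rule X)
  interpret S: normed_space "l1_sum X" by (rule normed_space_l1_sum[where X = X, OF X])
  assume "\<nexists>a. \<forall>x\<in>K. \<forall>b. (\<Sum>k\<in>{a..<b}. vnorm (X k) (x k)) \<le> e"
  then have "\<forall>a. \<exists>x b. x \<in> K \<and> e < (\<Sum>k\<in>{a..<b}. vnorm (X k) (x k))"
    by (meson not_le)
  then obtain u b where u: "\<And>a. u a \<in> K" and
    ub: "\<And>a. e < (\<Sum>k\<in>{a..<b a}. vnorm (X k) (u a k))"
    by metis
  \<comment> \<open>The block that starts at \<open>a j\<close> ends where the hump of \<open>u (a j)\<close> ends, and the next block starts there.\<close>
  define a where "a j = (b ^^ j) 0" for j
  have a_0: "a 0 = 0" and a_Suc: "a (Suc j) = b (a j)" for j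
    by (simp_all add: a_def)
  have a_mono: "a j \<le> a (Suc j)" for j
  proof (rule ccontr)
    assume "\<not> a j \<le> a (Suc j)"
    then show False using ub[of "a j"] \<open>0 < e\<close> by (simp add: a_Suc)
  qed
  define y where "y j = u (a j)" for j
  have yK: "y j \<in> K" for j by (simp add: y_def u)
  then have yS: "y j \<in> carrier (l1_sum X)" for j
    using K unfolding dunford_pettis_set_def by blast
  then have "\<exists>F\<in>carrier (dual_space (X k)). (\<forall>x\<in>carrier (X k). norm (F x) \<le> vnorm (X k) x) \<and>
      F (y j k) = of_real (vnorm (X k) (y j k))" for j k
    by (intro X.hahn_banach_norming) simp
  then have "\<exists>\<phi>. \<forall>j k. \<phi> j k \<in> carrier (dual_space (X k)) \<and>
      (\<forall>x\<in>carrier (X k). norm (\<phi> j k x) \<le> vnorm (X k) x) \<and>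
      \<phi> j k (y j k) = of_real (vnorm (X k) (y j k))"
    by (intro choice allI) blast
  then obtain \<phi> where \<phi>: "\<And>j k. \<phi> j k \<in> carrier (dual_space (X k))"
    and \<phi>_le: "\<And>j k x. x \<in> carrier (X k) \<Longrightarrow> norm (\<phi> j k x) \<le> vnorm (X k) x"
    and \<phi>_y: "\<And>j k. \<phi> j k (y j k) = of_real (vnorm (X k) (y j k))"
    by blast
  define g where "g j = (\<lambda>x\<in>carrier (l1_sum X). \<Sum>k\<in>{a j..<a (Suc j)}. \<phi> j k (x k))" for j
  have g_le: "norm (g j x) \<le> (\<Sum>k\<in>{a j..<a (Suc j)}. vnorm (X k) (x k))"
    if "x \<in> carrier (l1_sum X)" for j x
  proof -
    have "norm (g j x) \<le> (\<Sum>k\<in>{a j..<a (Suc j)}. norm (\<phi> j k (x k)))"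
      using that by (simp add: g_def norm_sum)
    also have "\<dots> \<le> (\<Sum>k\<in>{a j..<a (Suc j)}. vnorm (X k) (x k))"
      using that by (intro sum_mono \<phi>_le) simp
    finally show ?thesis .
  qed
  have "g j \<in> carrier (dual_space (l1_sum X))" for j
  proof (rule dual_space_carrierI)
    show "g j \<in> extensional (carrier (l1_sum X))" by (simp add: g_def)
    fix x assume x: "x \<in> carrier (l1_sum X)"
    show "norm (g j x) \<le> 1 * vnorm (l1_sum X) x"
      using g_le[OF x] sum_vnorm_le_l1_sum_vnorm[where X = X, OF X x, of "{a j..<a (Suc j)}"]
      by (simp del: l1_sum_simps) (rule order_trans)
    have "\<phi> j k ((c \<odot>\<^bsub>l1_sum X\<^esub> x) k) = c * \<phi> j k (x k)" for c k
      using x by (simp add: dual_space_carrierD(3)[OF \<phi>])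
    then show "g j (c \<odot>\<^bsub>l1_sum X\<^esub> x) = c * g j x" for c
      using x S.scale_closed[OF x, of c] by (simp add: g_def sum_distrib_left del: l1_sum_simps)
    fix z assume z: "z \<in> carrier (l1_sum X)"
    have "\<phi> j k ((x \<oplus>\<^bsub>l1_sum X\<^esub> z) k) = \<phi> j k (x k) + \<phi> j k (z k)" for k
      using x z by (simp add: dual_space_carrierD(2)[OF \<phi>])
    then show "g j (x \<oplus>\<^bsub>l1_sum X\<^esub> z) = g j x + g j z"
      using x z S.a_closed[OF x z] by (simp add: g_def sum.distrib del: l1_sum_simps)
  qed
  then have "weakly_null (dual_space (l1_sum X)) g"
  proof (rule S.weakly_null_dual_spaceI[where B = 1])
    fix x N assume x: "x \<in> carrier (l1_sum X)"
    have "(\<Sum>j<N. norm (g j x)) \<le> (\<Sum>j<N. \<Sum>k\<in>{a j..<a (Suc j)}. vnorm (X k) (x k))"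
      by (intro sum_mono g_le x)
    also have "\<dots> = (\<Sum>k<a N. vnorm (X k) (x k))"
      by (rule sum_consecutive_blocks[OF a_0 a_mono])
    also have "\<dots> \<le> vnorm (l1_sum X) x"
      by (rule sum_vnorm_le_l1_sum_vnorm[where X = X, OF X x]) simp
    finally show "(\<Sum>j<N. norm (g j x)) \<le> 1 * vnorm (l1_sum X) x" by simp
  qed simp
  then have "uniform_limit K g (\<lambda>_. 0) sequentially"
    using K by (simp add: dunford_pettis_set_def)
  then have "\<forall>\<^sub>F j in sequentially. \<forall>x\<in>K. dist (g j x) 0 < e"
    using \<open>0 < e\<close> by (simp add: uniform_limit_iff)
  then obtain j where "\<forall>x\<in>K. dist (g j x) 0 < e"
    using eventually_happens'[OF sequentially_bot] by blast
  then have "norm (g j (y j)) < e"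
    using yK by simp
  moreover have "g j (y j) = of_real (\<Sum>k\<in>{a j..<b (a j)}. vnorm (X k) (u (a j) k))"
    using yS[of j] by (simp add: g_def \<phi>_y a_Suc del: l1_sum_simps) (simp add: y_def)
  then have "e < norm (g j (y j))"
    using ub[of "a j"] \<open>0 < e\<close> by (simp del: of_real_sum)
  ultimately show False by simp
qed

section \<open>The \<open>p\<close>-(DPrcP) of an \<open>\<ell>\<^sub>1\<close>-sum\<close>

theorem proposition3p8:
  fixes p :: real and X :: "nat \<Rightarrow> ('k::real_or_complex, 'a) normed_module"
  assumes "1 \<le> p" and "\<And>n. banach_space (X n)"
  shows "(\<forall>n. p_DPrcP p (X n)) \<longleftrightarrow> p_DPrcP p (l1_sum X)"
proof -
  have X: "normed_space (X n)" for n
    using assms(2) by (simp add: banach_space_def)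
  note S = normed_space_l1_sum[where X = X, OF X]
  show ?thesis
  proof
    assume DP: "\<forall>k. p_DPrcP p (X k)"
    show "p_DPrcP p (l1_sum X)"
      unfolding p_DPrcP_def
    proof (intro allI impI)
      fix x assume x: "weakly_p_summable p (l1_sum X) x" "dunford_pettis_set (l1_sum X) (range x)"
      have xS: "x n \<in> carrier (l1_sum X)" for n
        using x(1) by (simp add: weakly_p_summable_def)
      have coord: "(\<lambda>n. vnorm (X k) (x n k)) \<longlonglongrightarrow> 0" for k
      proof -
        note T = bounded_operator_l1_sum_coordinate[where X = X, OF X, of k]
        have "dunford_pettis_set (X k) (range (\<lambda>n. x n k))"
          using dunford_pettis_set_bounded_operator[OF S X T x(2)] by (simp add: image_image)
        then show ?thesis
          using DP weakly_p_summable_bounded_operator[OF S X T x(1)] by (simp add: p_DPrcP_def)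
      qed
      show "(\<lambda>n. vnorm (l1_sum X) (x n)) \<longlonglongrightarrow> 0"
      proof (rule LIMSEQ_I)
        fix e :: real assume "0 < e"
        \<comment> \<open>Half of \<open>e\<close> is for the coordinates from \<open>a\<close> on, uniformly in \<open>n\<close>, and half for the finitely
          many coordinates before \<open>a\<close>.\<close>
        obtain a where a: "(\<Sum>k\<in>{a..<b}. vnorm (X k) (x n k)) \<le> e / 2" for n b
          using dunford_pettis_set_l1_sum_tails[where X = X, OF X x(2), of "e / 2"] \<open>0 < e\<close> by auto
        have "(\<lambda>n. \<Sum>k<a. vnorm (X k) (x n k)) \<longlonglongrightarrow> 0"
          using tendsto_sum[of "{..<a}" "\<lambda>k n. vnorm (X k) (x n k)" "\<lambda>_. 0"] coord by simp
        then obtain N where N: "\<And>n. N \<le> n \<Longrightarrow> norm ((\<Sum>k<a. vnorm (X k) (x n k)) - 0) < e / 2"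
          using LIMSEQ_D[of _ 0 "e / 2"] \<open>0 < e\<close> half_gt_zero by blast
        have "norm (vnorm (l1_sum X) (x n) - 0) < e" if "N \<le> n" for n
        proof -
          have head: "(\<Sum>k<a. vnorm (X k) (x n k)) < e / 2"
            using N[OF that] by simp
          have "(\<Sum>k<b. vnorm (X k) (x n k)) \<le> (\<Sum>k<a. vnorm (X k) (x n k)) + e / 2" for b
          proof -
            have "(\<Sum>k<b. vnorm (X k) (x n k)) \<le> (\<Sum>k\<in>{..<a} \<union> {a..<b}. vnorm (X k) (x n k))"
              using xS[of n] by (intro sum_mono2) (auto simp: normed_space.vnorm_nonneg[OF X])
            also have "\<dots> = (\<Sum>k<a. vnorm (X k) (x n k)) + (\<Sum>k\<in>{a..<b}. vnorm (X k) (x n k))"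
              by (intro sum.union_disjoint) auto
            finally show ?thesis using a[of n b] by linarith
          qed
          then have "vnorm (l1_sum X) (x n) \<le> (\<Sum>k<a. vnorm (X k) (x n k)) + e / 2"
            using xS[of n] by (simp add: suminf_le_const)
          moreover have "0 \<le> vnorm (l1_sum X) (x n)"
            by (rule normed_space.vnorm_nonneg[OF S xS])
          ultimately show ?thesis using head by (simp del: l1_sum_simps)
        qed
        then show "\<exists>N. \<forall>n\<ge>N. norm (vnorm (l1_sum X) (x n) - 0) < e" by blast
      qed
    qed
  next
    assume DP: "p_DPrcP p (l1_sum X)"
    show "\<forall>k. p_DPrcP p (X k)"
      unfolding p_DPrcP_def
    proof (intro allI impI)
      fix k x assume x: "weakly_p_summable p (X k) x" "dunford_pettis_set (X k) (range x)"
      note J = bounded_operator_l1_sum_inclusion[where X = X, OF X, of k]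
      have "dunford_pettis_set (l1_sum X) (range (\<lambda>n. l1_sum_inclusion X k (x n)))"
        using dunford_pettis_set_bounded_operator[OF X S J x(2)] by (simp add: image_image)
      then have "(\<lambda>n. vnorm (l1_sum X) (l1_sum_inclusion X k (x n))) \<longlonglongrightarrow> 0"
        using DP weakly_p_summable_bounded_operator[OF X S J x(1)] by (simp add: p_DPrcP_def)
      then show "(\<lambda>n. vnorm (X k) (x n)) \<longlonglongrightarrow> 0"
        by (simp add: sums_unique[OF l1_sum_inclusion_vnorm_sums[where X = X, OF X], symmetric])
    qed
  qed
qed

end
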